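(* Assume $Q(0)=0$ and $\lim_{|x|\to0}\frac{|Q(x)|}{|x|}=0$, and let $d$ be a process disturbance. Let $\Omega\succ0$ ($\Omega\in\mathbb S^{n\times n}$) and $\Delta$ (a real matrix with $s$ rows) be given. Suppose the following program is feasible: minimize $\|X_1G_2\|$ over $P_1\in\mathbb S^{n\times n}$, $Y_1\in\mathbb R^{T\times n}$, $G_2\in\mathbb R^{T\times(S-n)}$ and a scalar $\epsilon>0$, subject to $$Z_0Y_1=\begin{bmatrix}P_1\\ 0_{(S-n)\times n}\end{bmatrix},\qquad Z_0G_2=\begin{bmatrix}0_{n\times(S-n)}\\ I_{S-n}\end{bmatrix},$$ $$\begin{bmatrix}P_1-\Omega&(X_1Y_1)^\top&Y_1^\top\\ X_1Y_1&P_1-\epsilon E\Delta\Delta^\top E^\top&0_{n\times T}\\ Y_1&0_{T\times n}&\epsilon I_T\end{bmatrix}\succ0 .$$ If $D_0D_0^\top\preceq\Delta\Delta^\top$, then for any feasible point the control law $u=KZ(x)$ with $$K=U_0\begin{bmatrix}Y_1&G_2\end{bmatrix}\begin{bmatrix}P_1&0_{n\times(S-n)}\\ 0_{(S-n)\times n}&I_{S-n}\end{bmatrix}^{-1}$$ renders the origin an asymptotically stable equilibrium of the (undisturbed, $d\equiv0$) closed-loop system $x^+=AZ(x)+BKZ(x)$.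
   Context: Let $n,m,s,S,T$ be positive integers with $S\ge n$ (blocks of zero size are absent when $S=n$). Consider the discrete-time system $x^+=AZ(x)+Bu+Ed$, with $x\in\mathbb R^n$, $u\in\mathbb R^m$, $d\in\mathbb R^s$ an unknown signal, constant matrices $A\in\mathbb R^{n\times S}$, $B\in\mathbb R^{n\times m}$ (unknown), $E\in\mathbb R^{n\times s}$ (known), and $Z(x)=\begin{bmatrix}x\\ Q(x)\end{bmatrix}$ with known $Q:\mathbb R^n\to\mathbb R^{S-n}$. Data: samples satisfying $x(k+1)=AZ(x(k))+Bu(k)+Ed(k)$ for $k=0,\dots,T-1$. Define $U_0=[u(0)\ \cdots\ u(T-1)]$, $X_1=[x(1)\ \cdots\ x(T)]$, $Z_0=[Z(x(0))\ \cdots\ Z(x(T-1))]$, and the unknown matrix $D_0=[d(0)\ \cdots\ d(T-1)]\in\mathbb R^{s\times T}$. $\mathbb S^{n\times n}$ is the set of real symmetric $n\times n$ matrices; $\succ,\preceq$ denote the usual (semi)definite order; $|\cdot|$ is the Euclidean norm; $\|\cdot\|$ is any matrix norm. *)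

theory Defs
  imports Complex_Main "Jordan_Normal_Form.Gauss_Jordan_Elimination"
begin

(* Dimensions are natural numbers fixed by carrier_vec and carrier_mat, so that the blocks with
   S - n rows or columns may be empty. Types are written Matrix.vec to stay unambiguous next to
   Finite_Cartesian_Product. *)

definition vnorm :: "real Matrix.vec \<Rightarrow> real" where
  "vnorm v = sqrt (v \<bullet> v)"

definition sym_mats :: "nat \<Rightarrow> real mat set" where
  "sym_mats n = {M \<in> carrier_mat n n. transpose_mat M = M}"

definition pos_def :: "nat \<Rightarrow> real mat \<Rightarrow> bool" where
  "pos_def n M \<longleftrightarrow>
     M \<in> sym_mats n \<and> (\<forall>v \<in> carrier_vec n. v \<noteq> 0\<^sub>v n \<longrightarrow> v \<bullet> (M *\<^sub>v v) > 0)"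

definition pos_semidef :: "nat \<Rightarrow> real mat \<Rightarrow> bool" where
  "pos_semidef n M \<longleftrightarrow> M \<in> sym_mats n \<and> (\<forall>v \<in> carrier_vec n. v \<bullet> (M *\<^sub>v v) \<ge> 0)"

definition loewner_le :: "nat \<Rightarrow> real mat \<Rightarrow> real mat \<Rightarrow> bool" where
  "loewner_le n M N \<longleftrightarrow> M \<in> sym_mats n \<and> N \<in> sym_mats n \<and> pos_semidef n (N - M)"

definition append_cols :: "real mat \<Rightarrow> real mat \<Rightarrow> real mat" where
  "append_cols M N = four_block_mat M N (0\<^sub>m 0 (dim_col M)) (0\<^sub>m 0 (dim_col N))"

(* Total version of the library's partial inverse: an unspecified matrix if M is singular. *)
definition mat_inv :: "real mat \<Rightarrow> real mat" where
  "mat_inv M = the (mat_inverse M)"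

definition Z_of :: "(real Matrix.vec \<Rightarrow> real Matrix.vec) \<Rightarrow> real Matrix.vec \<Rightarrow> real Matrix.vec" where
  "Z_of Q x = x @\<^sub>v Q x"

(* The matrix [w 0, ..., w (T - 1)] whose columns are samples of dimension n. *)
definition data_mat :: "nat \<Rightarrow> nat \<Rightarrow> (nat \<Rightarrow> real Matrix.vec) \<Rightarrow> real mat" where
  "data_mat n T w = mat_of_cols n (map w [0..<T])"

definition lmi_mat ::
  "nat \<Rightarrow> nat \<Rightarrow> real mat \<Rightarrow> real mat \<Rightarrow> real mat \<Rightarrow> real mat \<Rightarrow> real mat \<Rightarrow> real mat \<Rightarrow> real \<Rightarrow> real mat"
where
  "lmi_mat n T X1 E \<Delta> \<Omega> P1 Y1 \<epsilon> =
     four_block_mat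
       (four_block_mat
          (P1 - \<Omega>)   (transpose_mat (X1 * Y1))
          (X1 * Y1)  (P1 - \<epsilon> \<cdot>\<^sub>m (E * \<Delta> * transpose_mat \<Delta> * transpose_mat E)))
       (transpose_mat Y1 @\<^sub>r 0\<^sub>m n T)
       (append_cols Y1 (0\<^sub>m T n))
       (\<epsilon> \<cdot>\<^sub>m 1\<^sub>m T)"

definition feasible_point ::
  "nat \<Rightarrow> nat \<Rightarrow> nat \<Rightarrow> real mat \<Rightarrow> real mat \<Rightarrow> real mat \<Rightarrow> real mat \<Rightarrow> real mat \<Rightarrow>
   real mat \<Rightarrow> real mat \<Rightarrow> real mat \<Rightarrow> real \<Rightarrow> bool"
where
  "feasible_point n S T X1 Z0 E \<Delta> \<Omega> P1 Y1 G2 \<epsilon> \<longleftrightarrow>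
     P1 \<in> sym_mats n \<and> Y1 \<in> carrier_mat T n \<and> G2 \<in> carrier_mat T (S - n) \<and> \<epsilon> > 0 \<and>
     Z0 * Y1 = P1 @\<^sub>r 0\<^sub>m (S - n) n \<and>
     Z0 * G2 = 0\<^sub>m n (S - n) @\<^sub>r 1\<^sub>m (S - n) \<and>
     pos_def (n + n + T) (lmi_mat n T X1 E \<Delta> \<Omega> P1 Y1 \<epsilon>)"

definition gain :: "nat \<Rightarrow> nat \<Rightarrow> real mat \<Rightarrow> real mat \<Rightarrow> real mat \<Rightarrow> real mat \<Rightarrow> real mat" where
  "gain n S U0 P1 Y1 G2 =
     U0 * append_cols Y1 G2 *
     mat_inv (four_block_mat P1 (0\<^sub>m n (S - n)) (0\<^sub>m (S - n) n) (1\<^sub>m (S - n)))"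

(* Local asymptotic stability: the origin is an equilibrium of x+ = f x, Lyapunov stable and
   locally attractive. *)
definition asymp_stable_origin :: "nat \<Rightarrow> (real Matrix.vec \<Rightarrow> real Matrix.vec) \<Rightarrow> bool" where
  "asymp_stable_origin n f \<longleftrightarrow>
     f (0\<^sub>v n) = 0\<^sub>v n \<and>
     (\<forall>\<epsilon>>0. \<exists>\<delta>>0. \<forall>x0 \<in> carrier_vec n. vnorm x0 < \<delta> \<longrightarrow> (\<forall>k. vnorm ((f ^^ k) x0) < \<epsilon>)) \<and>
     (\<exists>\<delta>>0. \<forall>x0 \<in> carrier_vec n. vnorm x0 < \<delta> \<longrightarrow> (\<lambda>k. vnorm ((f ^^ k) x0)) \<longlonglongrightarrow> 0)"

(* The filter |x| -> 0, x nonzero, on R^n; the type of vectors itself has no topology. *)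
definition norm_to_0 :: "nat \<Rightarrow> real Matrix.vec filter" where
  "norm_to_0 n = inf (filtercomap vnorm (at 0)) (principal (carrier_vec n))"

end

theory Submission
  imports Defs "Jordan_Normal_Form.Determinant"
begin

text \<open>Write \<open>N = X1 - E D0\<close> and \<open>W = P1\<inverse>\<close>. The constraints on \<open>Z0 Y1\<close> and \<open>Z0 G2\<close> turn the closed loop
  into \<open>v \<mapsto> N Y1 W v + N G2 Q(v)\<close>. The matrix inequality makes the norm of the form \<open>v \<bullet> W v\<close> contract under
  the linear part by a factor less than 1, and \<open>Q(v) = o(v)\<close> preserves this near the origin.\<close>

text \<open>The matrix \<open>N\<close> equals \<open>A * Z0 + B * U0\<close>. If a weight vector
  \<open>y\<close> on the samples satisfies \<open>Z0 y = Z(v)\<close> and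
  \<open>U0 y = K Z(v)\<close>, then the next state from \<open>v\<close> is \<open>N y\<close>; the
  constraints and the form of the gain supply such a \<open>y\<close> for every \<open>v\<close>, so
  the unknown \<open>A\<close> and \<open>B\<close> disappear from the closed loop. The obstacle is
  that \<open>N\<close> still contains the unknown \<open>D0\<close>, while the matrix inequality
  mentions only \<open>X1\<close>. It is therefore read as a scalar inequality in three free
  vectors: one is the state in the coordinates \<open>W v\<close>, one is spent on the disturbance,
  and minimising over the remaining one takes the form of \<open>P1\<close> to that of its inverse
  \<open>W\<close>. The strict decrease comes from \<open>\<Omega>\<close>, whose form dominates a
  fixed fraction of the form of \<open>P1\<close>. The Lyapunov function is \<open>qnorm W\<close>,
  the square root of the form, because a norm treats the term in \<open>Q(v)\<close> by the triangle
  inequality, whereas the form itself would leave a mixed term.\<close>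

section \<open>Quadratic forms and the norm of a positive definite matrix\<close>

definition qnorm :: "real mat \<Rightarrow> real Matrix.vec \<Rightarrow> real" where
  "qnorm M v = sqrt (v \<bullet> (M *\<^sub>v v))"

lemma sym_matsD:
  assumes "M \<in> sym_mats n"
  shows "M \<in> carrier_mat n n" "transpose_mat M = M"
  using assms by (auto simp: sym_mats_def)

lemma sym_mats_scalar_prod_commute:
  assumes "M \<in> sym_mats n" "u \<in> carrier_vec n" "v \<in> carrier_vec n"
  shows "u \<bullet> (M *\<^sub>v v) = v \<bullet> (M *\<^sub>v u)"
proof -
  have "u \<bullet> (M *\<^sub>v v) = (transpose_mat M *\<^sub>v u) \<bullet> v"
    using transpose_vec_mult_scalar[OF sym_matsD(1)[OF assms(1)] assms(3,2)] by simp
  also have "\<dots> = v \<bullet> (M *\<^sub>v u)"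
    using assms sym_matsD[OF assms(1)] by (metis comm_scalar_prod mult_mat_vec_carrier)
  finally show ?thesis .
qed

lemma quadratic_form_add:
  assumes "M \<in> sym_mats n" "u \<in> carrier_vec n" "v \<in> carrier_vec n"
  shows "(u + v) \<bullet> (M *\<^sub>v (u + v)) = u \<bullet> (M *\<^sub>v u) + 2 * (u \<bullet> (M *\<^sub>v v)) + v \<bullet> (M *\<^sub>v v)"
proof -
  note M = sym_matsD(1)[OF assms(1)]
  have Mu: "M *\<^sub>v u \<in> carrier_vec n" and Mv: "M *\<^sub>v v \<in> carrier_vec n"
    using M assms by auto
  show ?thesis
    using sym_mats_scalar_prod_commute[OF assms] assms Mu Mv
    by (simp add: mult_add_distrib_mat_vec[OF M] add_scalar_prod_distrib[of _ n]
        scalar_prod_add_distrib[of _ n])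
qed

lemma quadratic_form_smult:
  fixes M :: "real mat"
  assumes "M \<in> carrier_mat n n" "v \<in> carrier_vec n"
  shows "(t \<cdot>\<^sub>v v) \<bullet> (M *\<^sub>v (t \<cdot>\<^sub>v v)) = t\<^sup>2 * (v \<bullet> (M *\<^sub>v v))"
proof -
  have "M *\<^sub>v v \<in> carrier_vec n" using assms by auto
  then show ?thesis using assms by (simp add: mult_mat_vec[OF assms(1)] power2_eq_square)
qed

lemma pos_def_sym: "pos_def n M \<Longrightarrow> M \<in> sym_mats n"
  by (simp add: pos_def_def)

lemma pos_def_carrier: "pos_def n M \<Longrightarrow> M \<in> carrier_mat n n"
  by (simp add: pos_def_def sym_mats_def)

lemma pos_def_nonneg:
  assumes "pos_def n M" "v \<in> carrier_vec n"
  shows "0 \<le> v \<bullet> (M *\<^sub>v v)"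
proof (cases "v = 0\<^sub>v n")
  case True
  have "M *\<^sub>v v \<in> carrier_vec n" using pos_def_carrier[OF assms(1)] assms(2) by auto
  then show ?thesis using True by simp
next
  case False
  then show ?thesis using assms by (auto simp: pos_def_def less_imp_le)
qed

text \<open>The form at \<open>u + t v\<close> is a nonnegative quadratic polynomial in
  \<open>t\<close>, with positive leading coefficient unless \<open>v\<close> vanishes; its value at
  the minimiser \<open>t = - b / c\<close> is \<open>a - b^2 / c\<close>.\<close>

lemma pos_def_Cauchy_Schwarz:
  assumes "pos_def n M" "u \<in> carrier_vec n" "v \<in> carrier_vec n"
  shows "(u \<bullet> (M *\<^sub>v v))\<^sup>2 \<le> (u \<bullet> (M *\<^sub>v u)) * (v \<bullet> (M *\<^sub>v v))"
proof (cases "v = 0\<^sub>v n")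
  case True
  have "M *\<^sub>v u \<in> carrier_vec n" using pos_def_carrier[OF assms(1)] assms(2) by auto
  then have "u \<bullet> (M *\<^sub>v v) = 0"
    using True sym_mats_scalar_prod_commute[OF pos_def_sym[OF assms(1)] assms(2,3)] by simp
  then show ?thesis using pos_def_nonneg[OF assms(1)] assms by simp
next
  case False
  define a b c where "a = u \<bullet> (M *\<^sub>v u)" and "b = u \<bullet> (M *\<^sub>v v)" and "c = v \<bullet> (M *\<^sub>v v)"
  note M = pos_def_carrier[OF assms(1)]
  have c: "c > 0" using assms False by (auto simp: pos_def_def c_def)
  let ?t = "- b / c"
  have Mv: "M *\<^sub>v v \<in> carrier_vec n" using M assms by auto
  have quad: "(u + t \<cdot>\<^sub>v v) \<bullet> (M *\<^sub>v (u + t \<cdot>\<^sub>v v)) = a + 2 * (t * b) + t\<^sup>2 * c" for t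
  proof -
    have "t \<cdot>\<^sub>v v \<in> carrier_vec n" using assms by auto
    from quadratic_form_add[OF pos_def_sym[OF assms(1)] assms(2) this] show ?thesis
      using quadratic_form_smult[OF M assms(3), of t]
        scalar_prod_smult_distrib[OF assms(2) Mv, of t]
      by (simp only: mult_mat_vec[OF M assms(3)] a_def b_def c_def)
  qed
  have "0 \<le> (u + ?t \<cdot>\<^sub>v v) \<bullet> (M *\<^sub>v (u + ?t \<cdot>\<^sub>v v))"
    using pos_def_nonneg[OF assms(1)] assms by simp
  also have "\<dots> = a + 2 * (?t * b) + ?t\<^sup>2 * c"
    by (rule quad)
  also have "\<dots> = a - b\<^sup>2 / c"
    using c by (simp add: field_simps power2_eq_square)
  finally show ?thesis using c unfolding a_def[symmetric] b_def[symmetric] c_def[symmetric]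
    by (simp add: field_simps)
qed

lemma qnorm_triangle:
  assumes "pos_def n M" "u \<in> carrier_vec n" "v \<in> carrier_vec n"
  shows "qnorm M (u + v) \<le> qnorm M u + qnorm M v"
proof -
  let ?a = "u \<bullet> (M *\<^sub>v u)" and ?b = "u \<bullet> (M *\<^sub>v v)" and ?c = "v \<bullet> (M *\<^sub>v v)"
  have ac: "?a \<ge> 0" "?c \<ge> 0" using pos_def_nonneg assms by auto
  have "?b \<le> sqrt (?a * ?c)"
    using pos_def_Cauchy_Schwarz[OF assms] by (rule real_le_rsqrt)
  then have "?a + 2 * ?b + ?c \<le> (sqrt ?a + sqrt ?c)\<^sup>2"
    using ac by (simp add: power2_sum real_sqrt_mult)
  then show ?thesis
    unfolding qnorm_def quadratic_form_add[OF pos_def_sym[OF assms(1)] assms(2,3)]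
    using ac by (intro real_le_lsqrt) auto
qed

section \<open>Euclidean norm and upper bounds\<close>

text \<open>Makes the Euclidean norm a special case, so that its definiteness and its Cauchy-Schwarz
  inequality follow from the facts on positive definite forms.\<close>

lemma pos_def_one: "pos_def n (1\<^sub>m n)"
proof -
  have "v \<bullet> v > 0" if v: "v \<in> carrier_vec n" "v \<noteq> 0\<^sub>v n" for v :: "real Matrix.vec"
  proof -
    obtain i where i: "i < n" "v $ i \<noteq> 0"
      using v by (metis carrier_vecD eq_vecI index_zero_vec(1) index_zero_vec(2))
    then show ?thesis unfolding scalar_prod_def
      using v by (intro sum_pos2[of _ i]) (auto simp: zero_less_mult_iff)
  qed
  then show ?thesis by (auto simp: pos_def_def sym_mats_def)
qed

lemma scalar_prod_self_nonneg: "0 \<le> v \<bullet> (v :: real Matrix.vec)"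
  by (auto simp: scalar_prod_def intro: sum_nonneg)

lemma vnorm_nonneg: "0 \<le> vnorm v"
  by (simp add: vnorm_def scalar_prod_self_nonneg)

lemma vnorm_square: "(vnorm v)\<^sup>2 = v \<bullet> v"
  by (simp add: vnorm_def scalar_prod_self_nonneg)

lemma vnorm_zero: "vnorm (0\<^sub>v n) = 0"
  by (simp add: vnorm_def)

lemma vnorm_eq_zeroD:
  assumes "v \<in> carrier_vec n" "vnorm v = 0"
  shows "v = 0\<^sub>v n"
proof (rule ccontr)
  assume "v \<noteq> 0\<^sub>v n"
  then have "v \<bullet> v > 0" using pos_def_one assms(1) by (auto simp: pos_def_def)
  then show False using assms(2) by (simp add: vnorm_def)
qed

lemma abs_scalar_prod_le_vnorm:
  assumes "u \<in> carrier_vec n" "v \<in> carrier_vec n"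
  shows "\<bar>u \<bullet> v\<bar> \<le> vnorm u * vnorm v"
proof -
  have "(u \<bullet> v)\<^sup>2 \<le> (u \<bullet> u) * (v \<bullet> v)"
    using pos_def_Cauchy_Schwarz[OF pos_def_one assms] assms by simp
  then have "(u \<bullet> v)\<^sup>2 \<le> (vnorm u * vnorm v)\<^sup>2"
    by (simp add: power_mult_distrib vnorm_square)
  then show ?thesis using vnorm_nonneg by (simp add: abs_le_square_iff[symmetric])
qed

lemma vnorm_mult_mat_vec_bound:
  fixes M :: "real mat"
  assumes "M \<in> carrier_mat k n"
  obtains C where "C > 0" "\<And>v. v \<in> carrier_vec n \<Longrightarrow> vnorm (M *\<^sub>v v) \<le> C * vnorm v"
proof
  let ?F = "\<Sum>i<k. (vnorm (row M i))\<^sup>2"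
  have F: "?F \<ge> 0" by (simp add: sum_nonneg)
  \<comment> \<open>The root of \<open>?F\<close> is the Frobenius norm, which already bounds the
    operator. Adding 1 keeps the constant positive for the zero matrix as well, since later
    constants divide by it.\<close>
  show "sqrt ?F + 1 > 0" using F by (simp add: add_nonneg_pos)
  fix v :: "real Matrix.vec" assume v: "v \<in> carrier_vec n"
  have "(vnorm (M *\<^sub>v v))\<^sup>2 = (\<Sum>i<k. (row M i \<bullet> v)\<^sup>2)"
    unfolding vnorm_square using assms
    by (auto simp: scalar_prod_def[of "M *\<^sub>v v"] power2_eq_square lessThan_atLeast0
        intro!: sum.cong)
  also have "\<dots> \<le> (\<Sum>i<k. (vnorm (row M i) * vnorm v)\<^sup>2)"
  proof (rule sum_mono)
    fix i assume "i \<in> {..<k}"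
    then have "row M i \<in> carrier_vec n" using assms by auto
    from abs_scalar_prod_le_vnorm[OF this v]
    have "\<bar>row M i \<bullet> v\<bar>\<^sup>2 \<le> (vnorm (row M i) * vnorm v)\<^sup>2"
      by (intro power_mono) auto
    then show "(row M i \<bullet> v)\<^sup>2 \<le> (vnorm (row M i) * vnorm v)\<^sup>2" by simp
  qed
  also have "\<dots> = (sqrt ?F * vnorm v)\<^sup>2"
    using F by (simp add: power_mult_distrib sum_distrib_right)
  finally have "vnorm (M *\<^sub>v v) \<le> sqrt ?F * vnorm v"
    by (rule power2_le_imp_le) (simp add: F vnorm_nonneg)
  also have "\<dots> \<le> (sqrt ?F + 1) * vnorm v"
    using vnorm_nonneg by (simp add: distrib_right)
  finally show "vnorm (M *\<^sub>v v) \<le> (sqrt ?F + 1) * vnorm v" .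
qed

lemma quadratic_form_upper_bound:
  fixes M :: "real mat"
  assumes "M \<in> carrier_mat n n"
  obtains C where "C > 0" "\<And>v. v \<in> carrier_vec n \<Longrightarrow> v \<bullet> (M *\<^sub>v v) \<le> C * (vnorm v)\<^sup>2"
proof -
  obtain C where C: "C > 0" "\<And>v. v \<in> carrier_vec n \<Longrightarrow> vnorm (M *\<^sub>v v) \<le> C * vnorm v"
    using vnorm_mult_mat_vec_bound[OF assms] by blast
  have "v \<bullet> (M *\<^sub>v v) \<le> C * (vnorm v)\<^sup>2" if v: "v \<in> carrier_vec n" for v
  proof -
    have "v \<bullet> (M *\<^sub>v v) \<le> vnorm v * vnorm (M *\<^sub>v v)"
      using abs_scalar_prod_le_vnorm[OF v, of "M *\<^sub>v v"] assms v by auto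
    also have "\<dots> \<le> vnorm v * (C * vnorm v)"
      using C(2)[OF v] vnorm_nonneg by (intro mult_left_mono)
    finally show ?thesis by (simp add: power2_eq_square ac_simps)
  qed
  with C(1) show ?thesis using that by blast
qed

section \<open>Inverse and lower bound of a positive definite matrix\<close>

text \<open>Definiteness excludes kernel vectors, so the determinant is nonzero. The transpose of
  the inverse is again an inverse of the symmetric \<open>M\<close>, hence equal to it, and writing
  \<open>v\<close> as \<open>M (W v)\<close> turns the form of \<open>W\<close> at \<open>v\<close>
  into the form of \<open>M\<close> at \<open>W v\<close>.\<close>

lemma pos_def_inverse:
  assumes "pos_def n M"
  obtains W where "pos_def n W" "M * W = 1\<^sub>m n" "W * M = 1\<^sub>m n"
proof -
  note M = pos_def_carrier[OF assms]
  have "M *\<^sub>v v \<noteq> 0\<^sub>v n" if "v \<in> carrier_vec n" "v \<noteq> 0\<^sub>v n" for v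
    using assms that by (force simp: pos_def_def)
  then have "det M \<noteq> 0" using det_0_iff_vec_prod_zero[OF M] by auto
  then have "M \<in> Units (ring_mat TYPE(real) n ())" by (rule det_non_zero_imp_unit[OF M])
  then obtain W where "mat_inverse M = Some W" using mat_inverse(1)[OF M] by fastforce
  then have W: "W \<in> carrier_mat n n" "M * W = 1\<^sub>m n" "W * M = 1\<^sub>m n"
    using mat_inverse(2)[OF M] by auto
  have "transpose_mat W * M = 1\<^sub>m n"
    using transpose_mult[OF M W(1)] W(2) assms by (simp add: pos_def_def sym_mats_def)
  then have "transpose_mat W = transpose_mat W * (M * W)"
    using W by simp
  also have "\<dots> = transpose_mat W * M * W"
    using W(1) M by (simp add: assoc_mult_mat[of _ n n _ n _ n])
  also have "\<dots> = W"
    using \<open>transpose_mat W * M = 1\<^sub>m n\<close> W(1) by simp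
  finally have sym: "W \<in> sym_mats n" using W(1) by (simp add: sym_mats_def)
  have "v \<bullet> (W *\<^sub>v v) > 0" if v: "v \<in> carrier_vec n" "v \<noteq> 0\<^sub>v n" for v
  proof -
    have Wv: "W *\<^sub>v v \<in> carrier_vec n" using W v by auto
    have MWv: "M *\<^sub>v (W *\<^sub>v v) = v"
      using assoc_mult_mat_vec[OF M W(1) v(1)] W(2) v by simp
    have "W *\<^sub>v v \<noteq> 0\<^sub>v n" using MWv v M by force
    then have "0 < (W *\<^sub>v v) \<bullet> (M *\<^sub>v (W *\<^sub>v v))"
      using assms Wv by (simp add: pos_def_def)
    also have "\<dots> = v \<bullet> (W *\<^sub>v v)" using MWv comm_scalar_prod[OF Wv v(1)] by simp
    finally show ?thesis .
  qed
  with sym have "pos_def n W" by (simp add: pos_def_def)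
  then show ?thesis using W(2,3) by (rule that)
qed

text \<open>Applying Cauchy--Schwarz for \<open>M\<close> to \<open>v\<close> and \<open>M\<inverse> v\<close> bounds the form of \<open>M\<close> from below by the
  norm of \<open>M\<inverse>\<close>, so no compactness argument is needed.\<close>

lemma pos_def_lower_bound:
  assumes "pos_def n M"
  obtains c where "c > 0" "\<And>v. v \<in> carrier_vec n \<Longrightarrow> c * (vnorm v)\<^sup>2 \<le> v \<bullet> (M *\<^sub>v v)"
proof -
  note M = pos_def_carrier[OF assms]
  obtain W where W: "pos_def n W" "M * W = 1\<^sub>m n"
    using pos_def_inverse[OF assms] by blast
  note Wc = pos_def_carrier[OF W(1)]
  obtain C where C: "C > 0" "\<And>v. v \<in> carrier_vec n \<Longrightarrow> v \<bullet> (W *\<^sub>v v) \<le> C * (vnorm v)\<^sup>2"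
    using quadratic_form_upper_bound[OF Wc] by blast
  have "1 / C * (vnorm v)\<^sup>2 \<le> v \<bullet> (M *\<^sub>v v)" if v: "v \<in> carrier_vec n" for v
  proof (cases "v = 0\<^sub>v n")
    case True
    then show ?thesis using pos_def_nonneg[OF assms v] by (simp add: vnorm_zero)
  next
    case False
    then have pos: "(vnorm v)\<^sup>2 > 0"
      using vnorm_eq_zeroD[OF v] vnorm_nonneg[of v] by auto
    have Wv: "W *\<^sub>v v \<in> carrier_vec n" using Wc v by auto
    have MWv: "M *\<^sub>v (W *\<^sub>v v) = v"
      using assoc_mult_mat_vec[OF M Wc v] W(2) v by simp
    have "((vnorm v)\<^sup>2)\<^sup>2 \<le> (v \<bullet> (M *\<^sub>v v)) * (v \<bullet> (W *\<^sub>v v))"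
      using pos_def_Cauchy_Schwarz[OF assms v Wv] comm_scalar_prod[OF Wv v]
      by (simp add: MWv vnorm_square)
    also have "\<dots> \<le> (v \<bullet> (M *\<^sub>v v)) * (C * (vnorm v)\<^sup>2)"
      using C(2)[OF v] pos_def_nonneg[OF assms v] by (intro mult_left_mono)
    finally have "(vnorm v)\<^sup>2 * (vnorm v)\<^sup>2 \<le> (v \<bullet> (M *\<^sub>v v) * C) * (vnorm v)\<^sup>2"
      unfolding power2_eq_square[of "(vnorm v)\<^sup>2"] by (simp only: mult.assoc)
    then have "(vnorm v)\<^sup>2 \<le> v \<bullet> (M *\<^sub>v v) * C"
      using pos by (rule mult_right_le_imp_le)
    then show ?thesis using C(1) by (simp add: field_simps)
  qed
  with C(1) that[of "1 / C"] show ?thesis by simp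
qed

section \<open>Local stability from a contracted function\<close>

text \<open>The contraction is available only in the ball of radius \<open>\<eta>\<close>, so orbits
  must be shown not to leave it. The two-sided comparison of \<open>V\<close> with the norm
  translates decay of \<open>V\<close> into confinement to a ball.\<close>

lemma contraction_imp_asymp_stable_origin:
  assumes f_carrier: "\<And>v. v \<in> carrier_vec n \<Longrightarrow> f v \<in> carrier_vec n"
    and f_0: "f (0\<^sub>v n) = 0\<^sub>v n"
    and c: "c > 0" "\<And>v. v \<in> carrier_vec n \<Longrightarrow> c * vnorm v \<le> V v"
    and C: "C > 0" "\<And>v. v \<in> carrier_vec n \<Longrightarrow> V v \<le> C * vnorm v"
    and \<rho>: "0 \<le> \<rho>" "\<rho> < 1"
    and \<eta>: "\<eta> > 0"
    and contr: "\<And>v. v \<in> carrier_vec n \<Longrightarrow> vnorm v < \<eta> \<Longrightarrow> V (f v) \<le> \<rho> * V v"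
  shows "asymp_stable_origin n f"
proof -
  \<comment> \<open>Confinement and decay support each other in the induction: as long as
    \<open>V\<close> along the orbit stays at most \<open>C * vnorm v\<close>, which is less than
    \<open>c * \<eta>\<close> for these starting points, the norm stays below \<open>\<eta>\<close>
    and the next contraction step is allowed.\<close>
  have decay: "(f ^^ k) v \<in> carrier_vec n \<and> c * vnorm ((f ^^ k) v) \<le> \<rho> ^ k * (C * vnorm v)"
    if v: "v \<in> carrier_vec n" "vnorm v < c * \<eta> / C" for v k
  proof -
    have Cv: "C * vnorm v < c * \<eta>" using v C(1) by (simp add: field_simps)
    have "(f ^^ k) v \<in> carrier_vec n \<and> V ((f ^^ k) v) \<le> \<rho> ^ k * (C * vnorm v)"
    proof (induction k)
      case 0
      then show ?case using v C by simp
    next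
      case (Suc k)
      let ?w = "(f ^^ k) v"
      have w: "?w \<in> carrier_vec n" using Suc by simp
      have "c * vnorm ?w \<le> V ?w" using c w by simp
      also have "\<dots> \<le> \<rho> ^ k * (C * vnorm v)" using Suc by simp
      also have "\<dots> \<le> 1 * (C * vnorm v)"
        using \<rho> C(1) vnorm_nonneg by (intro mult_right_mono) (auto simp: power_le_one)
      also have "\<dots> < c * \<eta>" using Cv by simp
      finally have "vnorm ?w < \<eta>" using c(1) by simp
      then have "V (f ?w) \<le> \<rho> * V ?w" using contr w by simp
      also have "\<dots> \<le> \<rho> * (\<rho> ^ k * (C * vnorm v))"
        using Suc \<rho> by (intro mult_left_mono) auto
      finally show ?case using f_carrier w by simp
    qed
    then show ?thesis using c(2) by (meson order_trans)
  qed
  have r: "c * \<eta> / C > 0" using c C \<eta> by simp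
  show ?thesis unfolding asymp_stable_origin_def
  proof (intro conjI allI impI)
    fix \<epsilon> :: real assume e: "\<epsilon> > 0"
    show "\<exists>\<delta>>0. \<forall>x0\<in>carrier_vec n. vnorm x0 < \<delta> \<longrightarrow> (\<forall>k. vnorm ((f ^^ k) x0) < \<epsilon>)"
    \<comment> \<open>The first radius makes \<open>decay\<close> applicable; the second gives
      \<open>C * vnorm v < c * \<epsilon>\<close>, the bound needed after dividing by
      \<open>c\<close>.\<close>
    proof (intro exI[of _ "min (c * \<eta> / C) (c * \<epsilon> / C)"] conjI ballI impI allI)
      show "0 < min (c * \<eta> / C) (c * \<epsilon> / C)" using r c C e by simp
      fix v k assume v: "v \<in> carrier_vec n" "vnorm v < min (c * \<eta> / C) (c * \<epsilon> / C)"
      have "c * vnorm ((f ^^ k) v) \<le> \<rho> ^ k * (C * vnorm v)" using decay v by simp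
      also have "\<dots> \<le> 1 * (C * vnorm v)"
        using \<rho> C(1) vnorm_nonneg by (intro mult_right_mono) (auto simp: power_le_one)
      also have "\<dots> < c * \<epsilon>" using v C(1) by (simp add: field_simps)
      finally show "vnorm ((f ^^ k) v) < \<epsilon>" using c(1) by simp
    qed
  next
    show "\<exists>\<delta>>0. \<forall>x0\<in>carrier_vec n. vnorm x0 < \<delta> \<longrightarrow> (\<lambda>k. vnorm ((f ^^ k) x0)) \<longlonglongrightarrow> 0"
    proof (intro exI[of _ "c * \<eta> / C"] conjI ballI impI r)
      fix v assume v: "v \<in> carrier_vec n" "vnorm v < c * \<eta> / C"
      have "(\<lambda>k. \<rho> ^ k) \<longlonglongrightarrow> 0" using \<rho> by (intro LIMSEQ_realpow_zero)
      then have lim: "(\<lambda>k. \<rho> ^ k * (C * vnorm v / c)) \<longlonglongrightarrow> 0"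
        by (rule tendsto_mult_left_zero)
      have "vnorm ((f ^^ k) v) \<le> \<rho> ^ k * (C * vnorm v / c)" for k
        using decay[OF v, of k] c(1) by (simp add: field_simps)
      then show "(\<lambda>k. vnorm ((f ^^ k) v)) \<longlonglongrightarrow> 0"
        by (intro tendsto_sandwich[OF _ _ tendsto_const lim]) (auto simp: vnorm_nonneg)
    qed
  qed (rule f_0)
qed

text \<open>Replaces the limit by an estimate without quotient on a full ball. The filter leaves out
  the origin, where the estimate holds because \<open>q\<close> vanishes there.\<close>

lemma norm_to_0_imp_small_o:
  assumes "((\<lambda>v. vnorm (q v) / vnorm v) \<longlongrightarrow> 0) (norm_to_0 n)" "q (0\<^sub>v n) = 0\<^sub>v l" "e > 0"
  obtains \<eta> where "\<eta> > 0"
    "\<And>v. v \<in> carrier_vec n \<Longrightarrow> vnorm v < \<eta> \<Longrightarrow> vnorm (q v) \<le> e * vnorm v"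
proof -
  have "eventually (\<lambda>v. vnorm (q v) / vnorm v < e) (norm_to_0 n)"
    using order_tendstoD(2)[OF assms(1,3)] .
  \<comment> \<open>\<open>filtercomap\<close> yields a predicate of the norm alone, so that one
    radius serves all directions.\<close>
  then obtain R where R: "eventually R (at (0::real))"
    "\<And>v. R (vnorm v) \<Longrightarrow> v \<in> carrier_vec n \<Longrightarrow> vnorm (q v) / vnorm v < e"
    unfolding norm_to_0_def eventually_inf_principal eventually_filtercomap by blast
  then obtain \<eta> where \<eta>: "\<eta> > 0" "\<And>t. t \<noteq> 0 \<Longrightarrow> \<bar>t\<bar> < \<eta> \<Longrightarrow> R t"
    unfolding eventually_at by (auto simp: dist_real_def)
  have "vnorm (q v) \<le> e * vnorm v" if v: "v \<in> carrier_vec n" "vnorm v < \<eta>" for v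
  proof (cases "vnorm v = 0")
    case True
    then show ?thesis using vnorm_eq_zeroD[OF v(1)] assms(2) by (simp add: vnorm_zero)
  next
    case False
    then have "vnorm (q v) / vnorm v < e" using \<eta>(2) R(2) v vnorm_nonneg by simp
    then show ?thesis using False vnorm_nonneg[of v] by (simp add: field_simps)
  qed
  with \<eta>(1) that show ?thesis by blast
qed


section \<open>Forms and products of block matrices\<close>

lemma loewner_leD:
  assumes "loewner_le n M N" "v \<in> carrier_vec n"
  shows "v \<bullet> (M *\<^sub>v v) \<le> v \<bullet> (N *\<^sub>v v)"
proof -
  have MN: "M \<in> carrier_mat n n" "N \<in> carrier_mat n n" "0 \<le> v \<bullet> ((N - M) *\<^sub>v v)"
    using assms by (auto simp: loewner_le_def pos_semidef_def sym_mats_def)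
  have "M *\<^sub>v v \<in> carrier_vec n" "N *\<^sub>v v \<in> carrier_vec n" using MN assms by auto
  then show ?thesis
    using MN(3) by (simp add: minus_mult_distrib_mat_vec[OF MN(2,1) assms(2)]
        scalar_prod_minus_distrib[OF assms(2)])
qed

lemma scalar_prod_transpose_mat_vec:
  fixes M :: "real mat"
  assumes "M \<in> carrier_mat k n" "u \<in> carrier_vec n" "v \<in> carrier_vec k"
  shows "u \<bullet> (transpose_mat M *\<^sub>v v) = v \<bullet> (M *\<^sub>v u)"
proof -
  have "transpose_mat M *\<^sub>v v \<in> carrier_vec n" using assms by auto
  then show ?thesis
    using transpose_vec_mult_scalar[OF assms] comm_scalar_prod[OF assms(2)] by simp
qed

text \<open>Since \<open>append_cols\<close> is a block matrix with lower blocks of zero rows, the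
  block product carries an empty lower part, which the comparison of entries removes.\<close>

lemma append_cols_mult_vec:
  assumes "M \<in> carrier_mat k n1" "N \<in> carrier_mat k n2" "u \<in> carrier_vec n1" "v \<in> carrier_vec n2"
  shows "append_cols M N *\<^sub>v (u @\<^sub>v v) = M *\<^sub>v u + N *\<^sub>v v"
proof -
  have "append_cols M N *\<^sub>v (u @\<^sub>v v) =
      (M *\<^sub>v u + N *\<^sub>v v) @\<^sub>v (0\<^sub>m 0 n1 *\<^sub>v u + 0\<^sub>m 0 n2 *\<^sub>v v)"
    using assms unfolding append_cols_def
    by (subst four_block_mat_mult_vec[where ?nr1.0 = k and ?nr2.0 = 0]) auto
  also have "\<dots> = M *\<^sub>v u + N *\<^sub>v v"
    using assms by (intro eq_vecI) auto
  finally show ?thesis .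
qed

lemma append_cols_carrier:
  assumes "M \<in> carrier_mat k n1" "N \<in> carrier_mat k n2"
  shows "append_cols M N \<in> carrier_mat k (n1 + n2)"
  using assms by (auto simp: append_cols_def)

text \<open>Carries the disturbance bound, which compares matrices of size \<open>s\<close>, over to
  the block of size \<open>n\<close> in the matrix inequality.\<close>

lemma scalar_prod_mat_sandwich:
  fixes E M :: "real mat"
  assumes "E \<in> carrier_mat n s" "M \<in> carrier_mat s s" "b \<in> carrier_vec n"
  shows "b \<bullet> ((E * M * transpose_mat E) *\<^sub>v b) =
    (transpose_mat E *\<^sub>v b) \<bullet> (M *\<^sub>v (transpose_mat E *\<^sub>v b))"
proof -
  have v: "transpose_mat E *\<^sub>v b \<in> carrier_vec s" using assms by auto
  have "(E * M * transpose_mat E) *\<^sub>v b = E *\<^sub>v (M *\<^sub>v (transpose_mat E *\<^sub>v b))"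
    using assms v by (simp add: assoc_mult_mat_vec[of _ n s _ n] assoc_mult_mat_vec[of _ n s _ s])
  then show ?thesis
    using transpose_vec_mult_scalar[OF assms(1) _ assms(3), of "M *\<^sub>v (transpose_mat E *\<^sub>v b)"]
      assms v by simp
qed

section \<open>The matrix inequality as a scalar inequality\<close>

text \<open>The test vector is nested like the blocks of \<open>lmi_mat\<close>. Mutually transposed
  off-diagonal blocks contribute equal terms, whence the factors 2.\<close>

lemma lmi_mat_quadratic_form:
  fixes X1 Y1 E \<Delta> \<Omega> P1 :: "real mat"
  assumes X1: "X1 \<in> carrier_mat n T" and Y1: "Y1 \<in> carrier_mat T n"
    and E: "E \<in> carrier_mat n s" and \<Delta>: "\<Delta> \<in> carrier_mat s r"
    and \<Omega>: "\<Omega> \<in> carrier_mat n n" and P1: "P1 \<in> carrier_mat n n"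
    and a: "a \<in> carrier_vec n" and b: "b \<in> carrier_vec n" and c: "c \<in> carrier_vec T"
  shows "((a @\<^sub>v b) @\<^sub>v c) \<bullet> (lmi_mat n T X1 E \<Delta> \<Omega> P1 Y1 \<epsilon> *\<^sub>v ((a @\<^sub>v b) @\<^sub>v c)) =
    a \<bullet> (P1 *\<^sub>v a) - a \<bullet> (\<Omega> *\<^sub>v a) + 2 * (b \<bullet> (X1 *\<^sub>v (Y1 *\<^sub>v a))) + b \<bullet> (P1 *\<^sub>v b)
    - \<epsilon> * ((transpose_mat E *\<^sub>v b) \<bullet> ((\<Delta> * transpose_mat \<Delta>) *\<^sub>v (transpose_mat E *\<^sub>v b)))
    + 2 * (c \<bullet> (Y1 *\<^sub>v a)) + \<epsilon> * (c \<bullet> c)"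
proof -
  define G where "G = E * \<Delta> * transpose_mat \<Delta> * transpose_mat E"
  have G: "G \<in> carrier_mat n n" using E \<Delta> by (auto simp: G_def)
  have G_eq: "G = E * (\<Delta> * transpose_mat \<Delta>) * transpose_mat E"
    using E \<Delta> by (simp add: G_def assoc_mult_mat[of E n s \<Delta> r _ s])
  note XY = mult_carrier_mat[OF X1 Y1]
  have XYa: "(X1 * Y1) *\<^sub>v a = X1 *\<^sub>v (Y1 *\<^sub>v a)" by (rule assoc_mult_mat_vec[OF X1 Y1 a])
  have vecs: "P1 *\<^sub>v a \<in> carrier_vec n" "\<Omega> *\<^sub>v a \<in> carrier_vec n" "P1 *\<^sub>v b \<in> carrier_vec n"
    "G *\<^sub>v b \<in> carrier_vec n" "Y1 *\<^sub>v a \<in> carrier_vec T" "X1 *\<^sub>v (Y1 *\<^sub>v a) \<in> carrier_vec n"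
    "transpose_mat (X1 * Y1) *\<^sub>v b \<in> carrier_vec n" "transpose_mat Y1 *\<^sub>v c \<in> carrier_vec n"
    using assms G mult_mat_vec_carrier[OF transpose_carrier_mat[THEN iffD2, OF XY] b] by auto
  \<comment> \<open>\<open>p\<close> and \<open>q\<close> are what the upper left block makes of
    \<open>a\<close> and \<open>b\<close>; the contribution of \<open>c\<close> to the first row
    enters as a separate summand because of the nesting. \<open>y\<close> is the complete third
    block row.\<close>
  define p where "p = P1 *\<^sub>v a - \<Omega> *\<^sub>v a + transpose_mat (X1 * Y1) *\<^sub>v b"
  define q where "q = X1 *\<^sub>v (Y1 *\<^sub>v a) + (P1 *\<^sub>v b - \<epsilon> \<cdot>\<^sub>v (G *\<^sub>v b))"
  define y where "y = Y1 *\<^sub>v a + \<epsilon> \<cdot>\<^sub>v c"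
  have p: "p \<in> carrier_vec n" and q: "q \<in> carrier_vec n" and y: "y \<in> carrier_vec T"
    using vecs c by (auto simp: p_def q_def y_def)
  have top: "four_block_mat (P1 - \<Omega>) (transpose_mat (X1 * Y1)) (X1 * Y1) (P1 - \<epsilon> \<cdot>\<^sub>m G)
      *\<^sub>v (a @\<^sub>v b) = p @\<^sub>v q"
  proof (subst four_block_mat_mult_vec[of _ n n _ n _ n])
    have "(\<epsilon> \<cdot>\<^sub>m G) *\<^sub>v b = \<epsilon> \<cdot>\<^sub>v (G *\<^sub>v b)" using G b by (intro eq_vecI) auto
    then show "((P1 - \<Omega>) *\<^sub>v a + transpose_mat (X1 * Y1) *\<^sub>v b) @\<^sub>v
        ((X1 * Y1) *\<^sub>v a + (P1 - \<epsilon> \<cdot>\<^sub>m G) *\<^sub>v b) = p @\<^sub>v q"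
      using P1 \<Omega> G a b
      by (simp add: p_def q_def XYa minus_mult_distrib_mat_vec[of _ n n])
  qed (use assms G XY in auto)
  have right: "(transpose_mat Y1 @\<^sub>r 0\<^sub>m n T) *\<^sub>v c = (transpose_mat Y1 *\<^sub>v c) @\<^sub>v 0\<^sub>v n"
    using Y1 c by (subst mat_mult_append[of _ n T _ n]) auto
  have left: "append_cols Y1 (0\<^sub>m T n) *\<^sub>v (a @\<^sub>v b) = Y1 *\<^sub>v a"
    using Y1 a b by (subst append_cols_mult_vec[of _ T n _ n]) auto
  have bottom: "(\<epsilon> \<cdot>\<^sub>m 1\<^sub>m T) *\<^sub>v c = \<epsilon> \<cdot>\<^sub>v c" using c by (intro eq_vecI) auto
  have "lmi_mat n T X1 E \<Delta> \<Omega> P1 Y1 \<epsilon> *\<^sub>v ((a @\<^sub>v b) @\<^sub>v c) =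
      ((p @\<^sub>v q) + ((transpose_mat Y1 *\<^sub>v c) @\<^sub>v 0\<^sub>v n)) @\<^sub>v y"
    unfolding lmi_mat_def G_def[symmetric] y_def top[symmetric] right[symmetric] left[symmetric]
      bottom[symmetric]
  proof (rule four_block_mat_mult_vec)
    show "four_block_mat (P1 - \<Omega>) (transpose_mat (X1 * Y1)) (X1 * Y1) (P1 - \<epsilon> \<cdot>\<^sub>m G)
        \<in> carrier_mat (n + n) (n + n)"
      using G by (intro four_block_carrier_mat minus_carrier_mat \<Omega>) auto
    show "append_cols Y1 (0\<^sub>m T n) \<in> carrier_mat T (n + n)"
      using Y1 by (simp add: append_cols_carrier)
    show "transpose_mat Y1 @\<^sub>r 0\<^sub>m n T \<in> carrier_mat (n + n) T"
      using Y1 by (intro carrier_append_rows) auto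
  qed (use a b c in auto)
  also have "(p @\<^sub>v q) + ((transpose_mat Y1 *\<^sub>v c) @\<^sub>v 0\<^sub>v n) = (p + transpose_mat Y1 *\<^sub>v c) @\<^sub>v q"
    using append_vec_add[OF p vecs(8) q zero_carrier_vec] q by simp
  also have "((a @\<^sub>v b) @\<^sub>v c) \<bullet> (((p + transpose_mat Y1 *\<^sub>v c) @\<^sub>v q) @\<^sub>v y) =
      a \<bullet> (p + transpose_mat Y1 *\<^sub>v c) + b \<bullet> q + c \<bullet> y"
    by (simp only: scalar_prod_append[OF append_carrier_vec[OF a b] c
          append_carrier_vec[OF add_carrier_vec[OF p vecs(8)] q] y]
        scalar_prod_append[OF a b add_carrier_vec[OF p vecs(8)] q])
  also have "a \<bullet> (p + transpose_mat Y1 *\<^sub>v c) =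
      a \<bullet> (P1 *\<^sub>v a) - a \<bullet> (\<Omega> *\<^sub>v a) + a \<bullet> (transpose_mat (X1 * Y1) *\<^sub>v b)
      + a \<bullet> (transpose_mat Y1 *\<^sub>v c)"
    using scalar_prod_add_distrib[OF a p vecs(8)] scalar_prod_minus_distrib[OF a vecs(1,2)]
      scalar_prod_add_distrib[OF a minus_carrier_vec[OF vecs(1,2)] vecs(7)]
    by (simp add: p_def)
  also have "b \<bullet> q = b \<bullet> (X1 *\<^sub>v (Y1 *\<^sub>v a)) + b \<bullet> (P1 *\<^sub>v b) - \<epsilon> * (b \<bullet> (G *\<^sub>v b))"
    using scalar_prod_add_distrib[OF b vecs(6), of "P1 *\<^sub>v b - \<epsilon> \<cdot>\<^sub>v (G *\<^sub>v b)"]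
      scalar_prod_minus_distrib[OF b vecs(3) smult_carrier_vec[THEN iffD2, OF vecs(4)]]
      scalar_prod_smult_distrib[OF b vecs(4)] vecs
    by (simp add: q_def)
  also have "c \<bullet> y = c \<bullet> (Y1 *\<^sub>v a) + \<epsilon> * (c \<bullet> c)"
    using scalar_prod_add_distrib[OF c vecs(5), of "\<epsilon> \<cdot>\<^sub>v c"] c by (simp add: y_def)
  also have "a \<bullet> (transpose_mat (X1 * Y1) *\<^sub>v b) = b \<bullet> (X1 *\<^sub>v (Y1 *\<^sub>v a))"
    using scalar_prod_transpose_mat_vec[OF XY a b] XYa by simp
  also have "a \<bullet> (transpose_mat Y1 *\<^sub>v c) = c \<bullet> (Y1 *\<^sub>v a)"
    by (rule scalar_prod_transpose_mat_vec[OF Y1 a c])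
  also have "b \<bullet> (G *\<^sub>v b) =
      (transpose_mat E *\<^sub>v b) \<bullet> ((\<Delta> * transpose_mat \<Delta>) *\<^sub>v (transpose_mat E *\<^sub>v b))"
    unfolding G_eq using \<Delta> by (intro scalar_prod_mat_sandwich[OF E _ b]) auto
  finally show ?thesis by simp
qed

text \<open>Testing the matrix inequality with third component \<open>- D0\<^sup>T E\<^sup>T b\<close> replaces \<open>X1\<close> by the noise-free
  \<open>X1 - E D0\<close>; the remaining terms in \<open>\<epsilon>\<close> have the right sign by the disturbance bound. This takes
  the place of Petersen's lemma and of Schur complements.\<close>

lemma lmi_mat_robust:
  assumes X1: "X1 \<in> carrier_mat n T" and Y1: "Y1 \<in> carrier_mat T n"
    and E: "E \<in> carrier_mat n s" and \<Delta>: "\<Delta> \<in> carrier_mat s r"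
    and D0: "D0 \<in> carrier_mat s T"
    and \<Omega>: "\<Omega> \<in> carrier_mat n n" and P1: "P1 \<in> carrier_mat n n" and \<epsilon>: "\<epsilon> > 0"
    and lmi: "pos_def (n + n + T) (lmi_mat n T X1 E \<Delta> \<Omega> P1 Y1 \<epsilon>)"
    and disturbance: "loewner_le s (D0 * transpose_mat D0) (\<Delta> * transpose_mat \<Delta>)"
    and a: "a \<in> carrier_vec n" and b: "b \<in> carrier_vec n"
  shows "0 \<le> a \<bullet> (P1 *\<^sub>v a) - a \<bullet> (\<Omega> *\<^sub>v a)
    + 2 * (b \<bullet> ((X1 - E * D0) *\<^sub>v (Y1 *\<^sub>v a))) + b \<bullet> (P1 *\<^sub>v b)"
proof -
  define e where "e = transpose_mat E *\<^sub>v b"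
  define h where "h = transpose_mat D0 *\<^sub>v e"
  define y where "y = Y1 *\<^sub>v a"
  have vecs: "e \<in> carrier_vec s" "h \<in> carrier_vec T" "y \<in> carrier_vec T"
    "D0 *\<^sub>v y \<in> carrier_vec s" "X1 *\<^sub>v y \<in> carrier_vec n" "E *\<^sub>v (D0 *\<^sub>v y) \<in> carrier_vec n"
    using E D0 X1 Y1 a b by (auto simp: e_def h_def y_def)
  \<comment> \<open>This identity converts the mixed term of the third component into the correction
    that subtracts \<open>E * D0\<close> from \<open>X1\<close>.\<close>
  have h_y: "h \<bullet> y = b \<bullet> (E *\<^sub>v (D0 *\<^sub>v y))"
    using transpose_vec_mult_scalar[OF E vecs(4) b] transpose_vec_mult_scalar[OF D0 vecs(3,1)]
    by (simp add: h_def e_def)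
  have "(D0 * transpose_mat D0) *\<^sub>v e = D0 *\<^sub>v h"
    using D0 vecs by (simp add: h_def assoc_mult_mat_vec[of _ s T _ s])
  then have "h \<bullet> h = e \<bullet> ((D0 * transpose_mat D0) *\<^sub>v e)"
    using transpose_vec_mult_scalar[OF D0 vecs(2,1)] by (simp add: h_def)
  then have hh: "h \<bullet> h \<le> e \<bullet> ((\<Delta> * transpose_mat \<Delta>) *\<^sub>v e)"
    using loewner_leD[OF disturbance vecs(1)] by simp
  have mh: "(-1) \<cdot>\<^sub>v h \<in> carrier_vec T" using vecs by simp
  have "(a @\<^sub>v b) @\<^sub>v ((-1) \<cdot>\<^sub>v h) \<in> carrier_vec (n + n + T)" using a b mh by auto
  note pos_def_nonneg[OF lmi this]
  also have "((a @\<^sub>v b) @\<^sub>v ((-1) \<cdot>\<^sub>v h)) \<bullet>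
      (lmi_mat n T X1 E \<Delta> \<Omega> P1 Y1 \<epsilon> *\<^sub>v ((a @\<^sub>v b) @\<^sub>v ((-1) \<cdot>\<^sub>v h))) =
      a \<bullet> (P1 *\<^sub>v a) - a \<bullet> (\<Omega> *\<^sub>v a) + 2 * (b \<bullet> (X1 *\<^sub>v y)) + b \<bullet> (P1 *\<^sub>v b)
      - \<epsilon> * (e \<bullet> ((\<Delta> * transpose_mat \<Delta>) *\<^sub>v e)) - 2 * (h \<bullet> y) + \<epsilon> * (h \<bullet> h)"
    unfolding lmi_mat_quadratic_form[OF X1 Y1 E \<Delta> \<Omega> P1 a b mh] e_def[symmetric] y_def[symmetric]
    using vecs by simp
  also have "\<dots> \<le> a \<bullet> (P1 *\<^sub>v a) - a \<bullet> (\<Omega> *\<^sub>v a) + 2 * (b \<bullet> (X1 *\<^sub>v y)) + b \<bullet> (P1 *\<^sub>v b)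
      - 2 * (h \<bullet> y)"
    using mult_left_mono[OF hh, of \<epsilon>] \<epsilon> by simp
  also have "b \<bullet> (X1 *\<^sub>v y) = b \<bullet> ((X1 - E * D0) *\<^sub>v y) + h \<bullet> y"
    using X1 E D0 b vecs h_y
    by (simp add: minus_mult_distrib_mat_vec[of _ n T] assoc_mult_mat_vec[OF E D0]
        scalar_prod_minus_distrib[of _ n])
  finally show ?thesis by (simp add: y_def)
qed


section \<open>Contraction of the linear part and the nonlinear perturbation\<close>

text \<open>With \<open>a = W v\<close> the form of \<open>P1\<close> at \<open>a\<close> is the
  form of \<open>W\<close> at \<open>v\<close>. A suitable \<open>b\<close> then bounds the form of
  \<open>W\<close> at the image by that at \<open>v\<close> minus the form of
  \<open>\<Omega>\<close> at \<open>a\<close>, and this loss is at least a fixed fraction of the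
  form of \<open>W\<close> at \<open>v\<close>.\<close>

lemma Lyapunov_contraction:
  assumes P1: "pos_def n P1" and W: "pos_def n W" "P1 * W = 1\<^sub>m n"
    and \<Omega>: "pos_def n \<Omega>" and M: "M \<in> carrier_mat n n"
    and ineq: "\<And>a b. a \<in> carrier_vec n \<Longrightarrow> b \<in> carrier_vec n \<Longrightarrow>
      0 \<le> a \<bullet> (P1 *\<^sub>v a) - a \<bullet> (\<Omega> *\<^sub>v a) + 2 * (b \<bullet> (M *\<^sub>v a)) + b \<bullet> (P1 *\<^sub>v b)"
  obtains \<rho> where "0 \<le> \<rho>" "\<rho> < 1"
    "\<And>v. v \<in> carrier_vec n \<Longrightarrow> qnorm W (M *\<^sub>v (W *\<^sub>v v)) \<le> \<rho> * qnorm W v"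
proof -
  note carriers = pos_def_carrier[OF P1] pos_def_carrier[OF W(1)]
  have P1W: "P1 *\<^sub>v (W *\<^sub>v v) = v" if "v \<in> carrier_vec n" for v
    using assoc_mult_mat_vec[OF carriers that] W(2) that by simp
  have form_P1: "(W *\<^sub>v v) \<bullet> (P1 *\<^sub>v (W *\<^sub>v v)) = v \<bullet> (W *\<^sub>v v)" if "v \<in> carrier_vec n" for v
    using P1W[OF that] comm_scalar_prod[of "W *\<^sub>v v" n v] carriers that by simp
  obtain c where c: "c > 0" "\<And>v. v \<in> carrier_vec n \<Longrightarrow> c * (vnorm v)\<^sup>2 \<le> v \<bullet> (\<Omega> *\<^sub>v v)"
    using pos_def_lower_bound[OF \<Omega>] by blast
  obtain C where C: "C > 0" "\<And>v. v \<in> carrier_vec n \<Longrightarrow> v \<bullet> (P1 *\<^sub>v v) \<le> C * (vnorm v)\<^sup>2"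
    using quadratic_form_upper_bound[OF carriers(1)] by blast
  \<comment> \<open>As forms, \<open>\<Omega>\<close> is at least \<open>c\<close> and
    \<open>P1\<close> at most \<open>C\<close> times the squared norm, so \<open>\<Omega>\<close>
    dominates \<open>c / C\<close> times \<open>P1\<close>. The larger denominator
    \<open>C + c\<close> keeps the fraction below 1 without comparing \<open>c\<close> with
    \<open>C\<close>, so the root of \<open>1 - \<kappa>\<close> is a legitimate factor.\<close>
  define \<kappa> where "\<kappa> = c / (C + c)"
  have \<kappa>: "0 < \<kappa>" "\<kappa> < 1" using c(1) C(1) by (auto simp: \<kappa>_def field_simps)
  have "qnorm W (M *\<^sub>v (W *\<^sub>v v)) \<le> sqrt (1 - \<kappa>) * qnorm W v" if v: "v \<in> carrier_vec n" for v
  proof -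
    define a where "a = W *\<^sub>v v"
    define y where "y = M *\<^sub>v a"
    have a: "a \<in> carrier_vec n" and y: "y \<in> carrier_vec n" and Wy: "W *\<^sub>v y \<in> carrier_vec n"
      using carriers M v by (auto simp: a_def y_def)
    have "0 \<le> v \<bullet> (W *\<^sub>v v) - a \<bullet> (\<Omega> *\<^sub>v a) + 2 * (((-1) \<cdot>\<^sub>v (W *\<^sub>v y)) \<bullet> y) + y \<bullet> (W *\<^sub>v y)"
      \<comment> \<open>\<open>b = - W y\<close> minimises the quadratic in \<open>b\<close>\<close>
      using ineq[of a "(-1) \<cdot>\<^sub>v (W *\<^sub>v y)"] a Wy form_P1[OF v] form_P1[OF y]
        quadratic_form_smult[OF carriers(1) Wy, of "-1"]
      by (simp add: y_def[symmetric] a_def[symmetric])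
    also have "((-1) \<cdot>\<^sub>v (W *\<^sub>v y)) \<bullet> y = - (y \<bullet> (W *\<^sub>v y))"
      using smult_scalar_prod_distrib[OF Wy y, of "-1"] comm_scalar_prod[OF Wy y] by simp
    finally have decrease: "y \<bullet> (W *\<^sub>v y) \<le> v \<bullet> (W *\<^sub>v v) - a \<bullet> (\<Omega> *\<^sub>v a)" by simp
    have "(C + c) * (\<kappa> * (v \<bullet> (W *\<^sub>v v))) = c * (a \<bullet> (P1 *\<^sub>v a))"
      using form_P1[OF v] c(1) C(1) by (simp add: \<kappa>_def a_def)
    also have "\<dots> \<le> c * (C * (vnorm a)\<^sup>2)"
      using C(2)[OF a] c(1) by simp
    also have "\<dots> = C * (c * (vnorm a)\<^sup>2)" by simp
    also have "\<dots> \<le> C * (a \<bullet> (\<Omega> *\<^sub>v a))"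
      using c(2)[OF a] C(1) by (intro mult_left_mono) auto
    also have "\<dots> \<le> (C + c) * (a \<bullet> (\<Omega> *\<^sub>v a))"
      using pos_def_nonneg[OF \<Omega> a] c(1) by (intro mult_right_mono) auto
    finally have "\<kappa> * (v \<bullet> (W *\<^sub>v v)) \<le> a \<bullet> (\<Omega> *\<^sub>v a)" using c(1) C(1) by simp
    then have "y \<bullet> (W *\<^sub>v y) \<le> (1 - \<kappa>) * (v \<bullet> (W *\<^sub>v v))"
      using decrease by (simp add: left_diff_distrib)
    then show ?thesis
      unfolding qnorm_def y_def a_def real_sqrt_mult[symmetric] by (rule real_sqrt_le_mono)
  qed
  then show ?thesis using \<kappa> that[of "sqrt (1 - \<kappa>)"] by simp
qed

text \<open>Near the origin the nonlinear term costs at most half of the gap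
  \<open>1 - \<rho>\<close> left by the linear part, so the factor \<open>(1 + \<rho>) / 2\<close>
  remains.\<close>

lemma asymp_stable_origin_perturbed_linear:
  assumes F: "F \<in> carrier_mat n n" and H: "H \<in> carrier_mat n l" and W: "pos_def n W"
    and \<rho>: "0 \<le> \<rho>" "\<rho> < 1"
      "\<And>v. v \<in> carrier_vec n \<Longrightarrow> qnorm W (F *\<^sub>v v) \<le> \<rho> * qnorm W v"
    and Q_dim: "\<And>v. v \<in> carrier_vec n \<Longrightarrow> Q v \<in> carrier_vec l"
    and Q_0: "Q (0\<^sub>v n) = 0\<^sub>v l"
    and Q_lim: "((\<lambda>v. vnorm (Q v) / vnorm v) \<longlongrightarrow> 0) (norm_to_0 n)"
    and f: "\<And>v. v \<in> carrier_vec n \<Longrightarrow> f v = F *\<^sub>v v + H *\<^sub>v Q v"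
  shows "asymp_stable_origin n f"
proof -
  note Wc = pos_def_carrier[OF W]
  obtain c where c: "c > 0" "\<And>v. v \<in> carrier_vec n \<Longrightarrow> c * (vnorm v)\<^sup>2 \<le> v \<bullet> (W *\<^sub>v v)"
    using pos_def_lower_bound[OF W] by blast
  obtain C where C: "C > 0" "\<And>v. v \<in> carrier_vec n \<Longrightarrow> v \<bullet> (W *\<^sub>v v) \<le> C * (vnorm v)\<^sup>2"
    using quadratic_form_upper_bound[OF Wc] by blast
  have lower: "sqrt c * vnorm v \<le> qnorm W v" if "v \<in> carrier_vec n" for v
    using real_sqrt_le_mono[OF c(2)[OF that]] vnorm_nonneg[of v]
    by (simp add: qnorm_def real_sqrt_mult)
  have upper: "qnorm W v \<le> sqrt C * vnorm v" if "v \<in> carrier_vec n" for v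
    using real_sqrt_le_mono[OF C(2)[OF that]] vnorm_nonneg[of v]
    by (simp add: qnorm_def real_sqrt_mult)
  obtain h where h: "h > 0" "\<And>q. q \<in> carrier_vec l \<Longrightarrow> vnorm (H *\<^sub>v q) \<le> h * vnorm q"
    using vnorm_mult_mat_vec_bound[OF H] by blast
  \<comment> \<open>Solves \<open>sqrt C * h * e = (1 - \<rho>) / 2 * sqrt c\<close>: here
    \<open>h\<close> bounds \<open>H\<close>, and \<open>sqrt C\<close> and \<open>sqrt c\<close>
    convert between \<open>vnorm\<close> and \<open>qnorm W\<close>.\<close>
  define e where "e = (1 - \<rho>) / 2 * sqrt c / (sqrt C * h)"
  have e: "e > 0" using \<rho> c(1) C(1) h(1) by (simp add: e_def)
  obtain \<eta> where \<eta>: "\<eta> > 0"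
    "\<And>v. v \<in> carrier_vec n \<Longrightarrow> vnorm v < \<eta> \<Longrightarrow> vnorm (Q v) \<le> e * vnorm v"
    using norm_to_0_imp_small_o[OF Q_lim Q_0 e] by blast
  show ?thesis
  proof (rule contraction_imp_asymp_stable_origin[where V = "qnorm W" and c = "sqrt c"
        and C = "sqrt C" and \<rho> = "(1 + \<rho>) / 2" and \<eta> = \<eta>])
    fix v assume v: "v \<in> carrier_vec n" "vnorm v < \<eta>"
    have Fv: "F *\<^sub>v v \<in> carrier_vec n" and HQ: "H *\<^sub>v Q v \<in> carrier_vec n"
      using F H v Q_dim by auto
    have "qnorm W (H *\<^sub>v Q v) \<le> sqrt C * vnorm (H *\<^sub>v Q v)" using upper HQ by simp
    also have "\<dots> \<le> sqrt C * (h * (e * vnorm v))"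
      using order_trans[OF h(2)[OF Q_dim[OF v(1)]] mult_left_mono[OF \<eta>(2)[OF v], of h]] h(1) C(1)
      by (intro mult_left_mono) auto
    also have "\<dots> = (1 - \<rho>) / 2 * (sqrt c * vnorm v)"
      using h(1) C(1) by (simp add: e_def)
    also have "\<dots> \<le> (1 - \<rho>) / 2 * qnorm W v"
      using lower[OF v(1)] \<rho> by (intro mult_left_mono) auto
    finally have "qnorm W (f v) \<le> \<rho> * qnorm W v + (1 - \<rho>) / 2 * qnorm W v"
      using qnorm_triangle[OF W Fv HQ] \<rho>(3)[OF v(1)] f[OF v(1)] by simp
    then show "qnorm W (f v) \<le> (1 + \<rho>) / 2 * qnorm W v" by (simp add: field_simps)
  next
    show "f (0\<^sub>v n) = 0\<^sub>v n" 
      unfolding f[OF zero_carrier_vec] Q_0 using F H by (intro eq_vecI) auto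
  next
    fix v :: "real Matrix.vec" assume "v \<in> carrier_vec n"
    then show "f v \<in> carrier_vec n"
      unfolding f[OF \<open>v \<in> carrier_vec n\<close>] using F H Q_dim[of v]
      by (intro add_carrier_vec mult_mat_vec_carrier)
  qed (use c(1) C(1) \<rho> \<eta>(1) lower upper in auto)
qed

section \<open>Data matrices and the gain\<close>

lemma data_mat_carrier: "data_mat n T w \<in> carrier_mat n T"
  using mat_of_cols_carrier(1)[of n "map w [0..<T]"] by (simp add: data_mat_def)

lemma col_data_mat:
  assumes "k < T" "w k \<in> carrier_vec n"
  shows "col (data_mat n T w) k = w k"
  using assms by (simp add: data_mat_def)

text \<open>\<open>mat_inv\<close> selects from an option, so success of \<open>mat_inverse\<close>
  has to be secured as well: a one-sided inverse of a square matrix is two-sided, which makes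
  \<open>M\<close> a unit, and uniqueness of inverses identifies the result.\<close>

lemma mat_inv_eqI:
  assumes M: "M \<in> carrier_mat n n" and N: "N \<in> carrier_mat n n" and MN: "M * N = 1\<^sub>m n"
  shows "mat_inv M = N"
proof -
  have NM: "N * M = 1\<^sub>m n" by (rule mat_mult_left_right_inverse[OF M N MN])
  have "M \<in> Units (ring_mat TYPE(real) n ())"
    unfolding Units_def using M N MN NM by (auto simp: ring_mat_simps)
  then obtain N' where N': "mat_inverse M = Some N'"
    using mat_inverse(1)[OF M] by fastforce
  then have MN': "M * N' = 1\<^sub>m n" and N'c: "N' \<in> carrier_mat n n"
    using mat_inverse(2)[OF M] by auto
  have "N' = N * M * N'" unfolding NM using N'c by simp
  also have "\<dots> = N * (M * N')" by (rule assoc_mult_mat[OF N M N'c])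
  also have "\<dots> = N" unfolding MN' using N by simp
  finally have "N' = N" .
  then show ?thesis using N' by (simp add: mat_inv_def)
qed

text \<open>Each column of the identity is one sample equation. The nonlinearity is already
  evaluated in \<open>z\<close>, so the relation between the data is linear. Here \<open>x k\<close>
  stands for the successor of the \<open>k\<close>-th sampled state.\<close>

lemma data_mat_dynamics:
  assumes A: "A \<in> carrier_mat n S" and B: "B \<in> carrier_mat n m" and E: "E \<in> carrier_mat n s"
    and z: "\<And>k. k < T \<Longrightarrow> z k \<in> carrier_vec S"
    and u: "\<And>k. k < T \<Longrightarrow> u k \<in> carrier_vec m"
    and d: "\<And>k. k < T \<Longrightarrow> d k \<in> carrier_vec s"
    and samples: "\<And>k. k < T \<Longrightarrow> x k = A *\<^sub>v z k + B *\<^sub>v u k + E *\<^sub>v d k"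
  shows "data_mat n T x = A * data_mat S T z + B * data_mat m T u + E * data_mat s T d"
proof (rule mat_col_eqI)
  note AZ = mult_carrier_mat[OF A data_mat_carrier[of S T z]]
    and BU = mult_carrier_mat[OF B data_mat_carrier[of m T u]]
    and ED = mult_carrier_mat[OF E data_mat_carrier[of s T d]]
  fix k assume "k < dim_col (A * data_mat S T z + B * data_mat m T u + E * data_mat s T d)"
  then have k: "k < T" by (simp add: data_mat_def)
  have "x k \<in> carrier_vec n"
    unfolding samples[OF k] using A B E z[OF k] u[OF k] d[OF k]
    by (intro add_carrier_vec mult_mat_vec_carrier)
  then have "col (data_mat n T x) k = A *\<^sub>v z k + B *\<^sub>v u k + E *\<^sub>v d k"
    by (simp only: col_data_mat[of k T x n, OF k] samples[OF k, symmetric])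
  also have "\<dots> = col (A * data_mat S T z + B * data_mat m T u + E * data_mat s T d) k"
    by (simp only: col_add[OF add_carrier_mat[OF BU] ED k] col_add[OF AZ BU k]
        col_mult2[OF A data_mat_carrier k] col_mult2[OF B data_mat_carrier k]
        col_mult2[OF E data_mat_carrier k] col_data_mat[of k T z, OF k z[OF k]]
        col_data_mat[of k T u, OF k u[OF k]] col_data_mat[of k T d, OF k d[OF k]])
  finally show "col (data_mat n T x) k =
    col (A * data_mat S T z + B * data_mat m T u + E * data_mat s T d) k" .
next
  show "dim_row (data_mat n T x) =
      dim_row (A * data_mat S T z + B * data_mat m T u + E * data_mat s T d)"
    using E by (simp add: data_mat_def)
  show "dim_col (data_mat n T x) =
      dim_col (A * data_mat S T z + B * data_mat m T u + E * data_mat s T d)"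
    by (simp add: data_mat_def)
qed

text \<open>The block diagonal factor of the gain is inverted blockwise, with \<open>W\<close> and
  the identity as blocks. The input is thus the combination of the recorded inputs with the weights
  \<open>Y1 W v + G2 q\<close>.\<close>

lemma gain_mult_vec:
  assumes U0: "U0 \<in> carrier_mat m T" and Y1: "Y1 \<in> carrier_mat T n"
    and G2: "G2 \<in> carrier_mat T (S - n)" and P1: "P1 \<in> carrier_mat n n"
    and W: "W \<in> carrier_mat n n" "P1 * W = 1\<^sub>m n"
    and v: "v \<in> carrier_vec n" and q: "q \<in> carrier_vec (S - n)"
  shows "gain n S U0 P1 Y1 G2 *\<^sub>v (v @\<^sub>v q) = U0 *\<^sub>v (Y1 *\<^sub>v (W *\<^sub>v v) + G2 *\<^sub>v q)"
proof -
  define l where "l = S - n"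
  note G2 = G2[folded l_def] and q = q[folded l_def]
  let ?D = "\<lambda>M. four_block_mat M (0\<^sub>m n l) (0\<^sub>m l n) (1\<^sub>m l)"
  have D: "?D M \<in> carrier_mat (n + l) (n + l)" if "M \<in> carrier_mat n n" for M
    using that by (rule four_block_carrier_mat) auto
  have "?D P1 * ?D W = 1\<^sub>m (n + l)"
    using P1 W by (subst mult_four_block_mat[of _ n n _ l _ l]) (auto simp: four_block_one_mat)
  then have inv: "mat_inv (?D P1) = ?D W"
    using D P1 W by (intro mat_inv_eqI) auto
  have Wv: "W *\<^sub>v v \<in> carrier_vec n" using W v by auto
  have "?D W *\<^sub>v (v @\<^sub>v q) = (W *\<^sub>v v) @\<^sub>v q"
    using W v q Wv by (subst four_block_mat_mult_vec[of _ n n _ l _ l]) auto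
  then show ?thesis
    unfolding gain_def l_def[symmetric] inv
    using assoc_mult_mat_vec[OF mult_carrier_mat[OF U0 append_cols_carrier[OF Y1 G2]] D[OF W(1)],
        of "v @\<^sub>v q"]
      assoc_mult_mat_vec[OF U0 append_cols_carrier[OF Y1 G2], of "(W *\<^sub>v v) @\<^sub>v q"]
      append_cols_mult_vec[OF Y1 G2 Wv q] v q Wv
    by simp
qed

section \<open>Stability of the closed loop\<close>

theorem theorem6:
  fixes n m s S T r :: nat
    and A B E \<Omega> \<Delta> U0 X1 Z0 D0 P1 Y1 G2 K :: "real mat"
    and Q :: "real Matrix.vec \<Rightarrow> real Matrix.vec"
    and x u d :: "nat \<Rightarrow> real Matrix.vec"
    and \<epsilon> :: real
  assumes dims: "n > 0" "m > 0" "s > 0" "T > 0" "S \<ge> n"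
    and system: "A \<in> carrier_mat n S" "B \<in> carrier_mat n m" "E \<in> carrier_mat n s"
    and Q_dim: "\<And>v. v \<in> carrier_vec n \<Longrightarrow> Q v \<in> carrier_vec (S - n)"
    and Q_0: "Q (0\<^sub>v n) = 0\<^sub>v (S - n)"
    and Q_lim: "((\<lambda>v. vnorm (Q v) / vnorm v) \<longlongrightarrow> 0) (norm_to_0 n)"
    and x_dim: "\<And>k. k \<le> T \<Longrightarrow> x k \<in> carrier_vec n"
    and u_dim: "\<And>k. k < T \<Longrightarrow> u k \<in> carrier_vec m"
    and d_dim: "\<And>k. k < T \<Longrightarrow> d k \<in> carrier_vec s"
    and samples: "\<And>k. k < T \<Longrightarrow> x (k + 1) = A *\<^sub>v Z_of Q (x k) + B *\<^sub>v u k + E *\<^sub>v d k"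
    and U0: "U0 = data_mat m T u"
    and X1: "X1 = data_mat n T (\<lambda>k. x (k + 1))"
    and Z0: "Z0 = data_mat S T (\<lambda>k. Z_of Q (x k))"
    and D0: "D0 = data_mat s T d"
    and \<Omega>: "pos_def n \<Omega>"
    and \<Delta>: "\<Delta> \<in> carrier_mat s r"
    and feasible: "feasible_point n S T X1 Z0 E \<Delta> \<Omega> P1 Y1 G2 \<epsilon>"
    and disturbance: "loewner_le s (D0 * transpose_mat D0) (\<Delta> * transpose_mat \<Delta>)"
    and K: "K = gain n S U0 P1 Y1 G2"
  shows "asymp_stable_origin n (\<lambda>v. A *\<^sub>v Z_of Q v + B *\<^sub>v (K *\<^sub>v Z_of Q v))"
proof -
  define z where "z = (\<lambda>k. Z_of Q (x k))"
  define N where "N = X1 - E * D0"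
  have S: "n + (S - n) = S" using dims by simp
  have Z_dim: "Z_of Q v \<in> carrier_vec S" if "v \<in> carrier_vec n" for v
    using append_carrier_vec[OF that Q_dim[OF that]] S by (simp add: Z_of_def)
  have Y1: "Y1 \<in> carrier_mat T n" and G2: "G2 \<in> carrier_mat T (S - n)" and \<epsilon>: "\<epsilon> > 0"
    and P1_sym: "P1 \<in> sym_mats n"
    and ZY: "Z0 * Y1 = P1 @\<^sub>r 0\<^sub>m (S - n) n"
    and ZG: "Z0 * G2 = 0\<^sub>m n (S - n) @\<^sub>r 1\<^sub>m (S - n)"
    and lmi: "pos_def (n + n + T) (lmi_mat n T X1 E \<Delta> \<Omega> P1 Y1 \<epsilon>)"
    using feasible by (auto simp: feasible_point_def)
  note P1c = sym_matsD(1)[OF P1_sym]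
  have data: "X1 \<in> carrier_mat n T" "U0 \<in> carrier_mat m T" "Z0 \<in> carrier_mat S T"
    "D0 \<in> carrier_mat s T"
    unfolding X1 U0 Z0 D0 by (rule data_mat_carrier)+
  have N: "N \<in> carrier_mat n T"
    unfolding N_def by (intro minus_carrier_mat mult_carrier_mat[OF system(3) data(4)])
  have robust: "0 \<le> a \<bullet> (P1 *\<^sub>v a) - a \<bullet> (\<Omega> *\<^sub>v a) + 2 * (b \<bullet> ((N * Y1) *\<^sub>v a)) + b \<bullet> (P1 *\<^sub>v b)"
    if "a \<in> carrier_vec n" "b \<in> carrier_vec n" for a b
    using lmi_mat_robust[OF data(1) Y1 system(3) \<Delta> data(4) pos_def_carrier[OF \<Omega>] P1c \<epsilon> lmi
        disturbance that] assoc_mult_mat_vec[OF N Y1 that(1)]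
    by (simp add: N_def)
  \<comment> \<open>Feasibility provides only symmetry of \<open>P1\<close>. Taking
    \<open>b = 0\<close> in \<open>robust\<close> shows that its form dominates that of
    \<open>\<Omega>\<close>, hence is positive.\<close>
  have P1: "pos_def n P1"
    unfolding pos_def_def
  proof (intro conjI P1_sym ballI impI)
    fix v :: "real Matrix.vec" assume v: "v \<in> carrier_vec n" "v \<noteq> 0\<^sub>v n"
    have "0 \<le> v \<bullet> (P1 *\<^sub>v v) - v \<bullet> (\<Omega> *\<^sub>v v)"
      using robust[OF v(1) zero_carrier_vec] P1c mult_mat_vec_carrier[OF N, of "Y1 *\<^sub>v v"] N Y1 v
      by simp
    then show "0 < v \<bullet> (P1 *\<^sub>v v)" using \<Omega> v by (force simp: pos_def_def)
  qed
  obtain W where W: "pos_def n W" "P1 * W = 1\<^sub>m n"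
    using pos_def_inverse[OF P1] by blast
  note Wc = pos_def_carrier[OF W(1)]
  have NY: "N * Y1 \<in> carrier_mat n n" using N Y1 by auto
  obtain \<rho> where \<rho>: "0 \<le> \<rho>" "\<rho> < 1"
    "\<And>v. v \<in> carrier_vec n \<Longrightarrow> qnorm W ((N * Y1) *\<^sub>v (W *\<^sub>v v)) \<le> \<rho> * qnorm W v"
    using Lyapunov_contraction[OF P1 W \<Omega> NY robust] by blast
  have dynamics: "X1 = A * Z0 + B * U0 + E * D0"
    unfolding X1 Z0 U0 D0 using Z_dim x_dim u_dim d_dim samples
    by (intro data_mat_dynamics[OF system]) auto
  have closed_loop: "A *\<^sub>v Z_of Q v + B *\<^sub>v (K *\<^sub>v Z_of Q v) =
      (N * Y1 * W) *\<^sub>v v + (N * G2) *\<^sub>v Q v" if v: "v \<in> carrier_vec n" for v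
  proof -
    have Wv: "W *\<^sub>v v \<in> carrier_vec n" using Wc v by auto
    \<comment> \<open>The weights on the samples that reproduce \<open>Z_of Q v\<close> from
      \<open>Z0\<close> and the control input from \<open>U0\<close>: the \<open>Y1\<close> part
      contributes the state block \<open>v\<close>, the \<open>G2\<close> part the block
      \<open>Q v\<close>.\<close>
    define y where "y = Y1 *\<^sub>v (W *\<^sub>v v) + G2 *\<^sub>v Q v"
    have YW: "Y1 *\<^sub>v (W *\<^sub>v v) \<in> carrier_vec T" and GQ: "G2 *\<^sub>v Q v \<in> carrier_vec T"
      using Y1 G2 Wv Q_dim[OF v] by auto
    then have y: "y \<in> carrier_vec T" by (simp add: y_def)
    have KZ: "K *\<^sub>v Z_of Q v = U0 *\<^sub>v y"
      unfolding K Z_of_def y_def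
      by (rule gain_mult_vec[OF data(2) Y1 G2 P1c Wc W(2) v Q_dim[OF v]])
    have "Z0 *\<^sub>v y = (Z0 * Y1) *\<^sub>v (W *\<^sub>v v) + (Z0 * G2) *\<^sub>v Q v"
      using mult_add_distrib_mat_vec[OF data(3) YW GQ] assoc_mult_mat_vec[OF data(3) Y1 Wv]
        assoc_mult_mat_vec[OF data(3) G2 Q_dim[OF v]]
      by (simp add: y_def)
    also have "(Z0 * Y1) *\<^sub>v (W *\<^sub>v v) = v @\<^sub>v 0\<^sub>v (S - n)"
      unfolding ZY using assoc_mult_mat_vec[OF P1c Wc v] W(2) Wv v
      by (subst mat_mult_append[OF P1c zero_carrier_mat Wv]) auto
    also have "(Z0 * G2) *\<^sub>v Q v = 0\<^sub>v n @\<^sub>v Q v"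
      unfolding ZG using Q_dim[OF v]
      by (subst mat_mult_append[OF zero_carrier_mat one_carrier_mat]) auto
    also have "(v @\<^sub>v 0\<^sub>v (S - n)) + (0\<^sub>v n @\<^sub>v Q v) = Z_of Q v"
      using v Q_dim[OF v] append_vec_add[OF v zero_carrier_vec zero_carrier_vec Q_dim[OF v]]
      by (simp add: Z_of_def)
    finally have Zy: "Z0 *\<^sub>v y = Z_of Q v" .
    have "N *\<^sub>v y = X1 *\<^sub>v y - E *\<^sub>v (D0 *\<^sub>v y)"
      using minus_mult_distrib_mat_vec[OF data(1) mult_carrier_mat[OF system(3) data(4)] y]
        assoc_mult_mat_vec[OF system(3) data(4) y]
      by (simp add: N_def)
    also have "X1 *\<^sub>v y = A *\<^sub>v Z_of Q v + B *\<^sub>v (U0 *\<^sub>v y) + E *\<^sub>v (D0 *\<^sub>v y)"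
      unfolding dynamics Zy[symmetric] using system data y
      by (simp add: add_mult_distrib_mat_vec[of _ n T] assoc_mult_mat_vec[OF system(1) data(3)]
          assoc_mult_mat_vec[OF system(2) data(2)] assoc_mult_mat_vec[OF system(3) data(4)])
    \<comment> \<open>The recorded disturbance cancels, so data taken under disturbance describe the
      undisturbed closed loop exactly.\<close>
    also have "\<dots> - E *\<^sub>v (D0 *\<^sub>v y) = A *\<^sub>v Z_of Q v + B *\<^sub>v (U0 *\<^sub>v y)"
      using system by (intro eq_vecI) auto
    finally have "A *\<^sub>v Z_of Q v + B *\<^sub>v (K *\<^sub>v Z_of Q v) = N *\<^sub>v y" by (simp add: KZ)
    also have "\<dots> = (N * Y1 * W) *\<^sub>v v + (N * G2) *\<^sub>v Q v"
      using mult_add_distrib_mat_vec[OF N YW GQ] assoc_mult_mat_vec[OF N Y1 Wv]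
        assoc_mult_mat_vec[OF NY Wc v] assoc_mult_mat_vec[OF N G2 Q_dim[OF v]]
      by (simp add: y_def)
    finally show ?thesis .
  qed
  show ?thesis
  proof (rule asymp_stable_origin_perturbed_linear[OF _ _ W(1) \<rho>(1,2) _ Q_dim Q_0 Q_lim closed_loop])
    show "N * Y1 * W \<in> carrier_mat n n" "N * G2 \<in> carrier_mat n (S - n)"
      using NY Wc N G2 by auto
    show "qnorm W ((N * Y1 * W) *\<^sub>v v) \<le> \<rho> * qnorm W v" if "v \<in> carrier_vec n" for v
      using \<rho>(3)[OF that] assoc_mult_mat_vec[OF NY Wc that] by simp
  qed
qed

end
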